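(* Let $G=(V,E)$ be a finite connected loopless multigraph, let $I\subseteq E$, let $x_v>0$ for all $v\in V$ and $y_e>0$ for $e\in E\setminus I$, and let $\alpha'>0$. Then $$\mathcal I_G^{\mathrm{zono}}(\alpha')\big|_{y_e=0\ (e\in I)}=\mathcal I_{G\setminus I}^{\mathrm{zono}}(\alpha')=\prod_{i=1}^r\mathcal I_{K_i}^{\mathrm{zono}}(\alpha'),$$ where $G\setminus I$ is obtained from $G$ by deleting the edges in $I$ (keeping all vertices, the site energies, and the remaining edge energies) and $K_1,\ldots,K_r$ are the connected components of $G\setminus I$, each of which may be a single vertex.
   Context: Loopless means no self-loops; cycles and parallel edges are allowed. For a finite loopless multigraph $H=(V(H),E(H))$, not necessarily connected, with site energies $x_v$ and edge energies $y_e$, $$\mathcal I_H^{\mathrm{zono}}(\alpha')=(\alpha')^{|V(H)|}\int_{\mathbb R^{V(H)}}\prod_{v\in V(H)}\mathrm d\tau_v\prod_{v\in V(H)}(2\cosh\tau_v)^{-\alpha' x_v}\prod_{e=uv\in E(H)}(2\cosh(\tau_u-\tau_v))^{-\alpha' y_e}.$$ *)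

theory Defs
  imports "HOL-Analysis.Analysis" "HOL-Library.Uprod"
begin

section \<open>Undirected multigraphs\<close>

text \<open>Edges are abstract objects with an unordered pair of end vertices, so parallel edges
  are distinct edges with equal ends.  The values of \<open>ends\<close> outside \<open>edges\<close> are irrelevant.\<close>

record ('v, 'e) multigraph =
  verts :: "'v set"
  edges :: "'e set"
  ends :: "'e \<Rightarrow> 'v uprod"

definition finite_loopless_multigraph :: "('v, 'e) multigraph \<Rightarrow> bool" where
  "finite_loopless_multigraph H \<longleftrightarrow>
     finite (verts H) \<and> finite (edges H) \<and>
     (\<forall>e\<in>edges H. set_uprod (ends H e) \<subseteq> verts H \<and> proper_uprod (ends H e))"

definition adjacency :: "('v, 'e) multigraph \<Rightarrow> 'v rel" where
  "adjacency H = {(u, v). \<exists>e\<in>edges H. ends H e = Upair u v}"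

definition reachable :: "('v, 'e) multigraph \<Rightarrow> 'v rel" where
  "reachable H = {(u, v). u \<in> verts H \<and> v \<in> verts H \<and> (u, v) \<in> (adjacency H)\<^sup>*}"

definition connected_multigraph :: "('v, 'e) multigraph \<Rightarrow> bool" where
  "connected_multigraph H \<longleftrightarrow>
     verts H \<noteq> {} \<and> (\<forall>u\<in>verts H. \<forall>v\<in>verts H. (u, v) \<in> reachable H)"

definition delete_edges :: "('v, 'e) multigraph \<Rightarrow> 'e set \<Rightarrow> ('v, 'e) multigraph" where
  "delete_edges H I = H\<lparr>edges := edges H - I\<rparr>"

definition induced_multigraph :: "('v, 'e) multigraph \<Rightarrow> 'v set \<Rightarrow> ('v, 'e) multigraph" where
  "induced_multigraph H C =
     H\<lparr>verts := C, edges := {e \<in> edges H. set_uprod (ends H e) \<subseteq> C}\<rparr>"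

definition components_multigraph :: "('v, 'e) multigraph \<Rightarrow> ('v, 'e) multigraph set" where
  "components_multigraph H = induced_multigraph H ` (verts H // reachable H)"

section \<open>The zonotopal integral\<close>

text \<open>For an edge with ends \<open>u\<close> and \<open>v\<close> this is \<open>2 cosh (\<tau> u - \<tau> v)\<close>, which is well defined
  on unordered pairs because \<open>cosh\<close> is even.\<close>

lift_definition edge_cosh :: "('v \<Rightarrow> real) \<Rightarrow> 'v uprod \<Rightarrow> real"
  is "\<lambda>\<tau> (u, v). 2 * cosh (\<tau> u - \<tau> v)"
  using cosh_minus[where 'a = real] by (fastforce simp: minus_diff_eq)

lemma edge_cosh_Upair [simp]: "edge_cosh \<tau> (Upair u v) = 2 * cosh (\<tau> u - \<tau> v)"
  by transfer simp

definition zono_integral ::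
  "('v, 'e) multigraph \<Rightarrow> ('v \<Rightarrow> real) \<Rightarrow> ('e \<Rightarrow> real) \<Rightarrow> real \<Rightarrow> real" where
  "zono_integral H x y a =
     a ^ card (verts H) *
     (LINT \<tau>|(\<Pi>\<^sub>M v\<in>verts H. lborel).
        (\<Prod>v\<in>verts H. (2 * cosh (\<tau> v)) powr (- a * x v)) *
        (\<Prod>e\<in>edges H. edge_cosh \<tau> (ends H e) powr (- a * y e)))"

end

theory Submission
  imports Defs
begin

text \<open>An edge energy 0 turns its factor into a power with exponent 0 of the positive number
  \<open>edge_cosh\<close>, that is 1, so setting energies to 0 amounts to deleting edges
  (\<open>zono_integral_delete_edges\<close>). For the second equality, the classes of
  \<open>reachable\<close> partition the vertices, and no edge joins two classes, so they partition
  the edges as well. Hence the integrand is a product of functions in disjoint blocks of variables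
  (\<open>zono_integrand_eq_prod_components\<close>). Being nonnegative, it can be integrated block
  by block with Tonelli (\<open>integral_PiM_Union_disjoint_nonneg\<close>), and the prefactor
  splits because the class sizes add up to the number of vertices. Passing between
  \<open>ennreal\<close> and real integrals is harmless: \<open>enn2real\<close> is multiplicative
  even at infinity, which it sends to 0.\<close>

lemma enn2real_prod: "enn2real (\<Prod>i\<in>A. f i) = (\<Prod>i\<in>A. enn2real (f i))"
  by (induction A rule: infinite_finite_induct) (auto simp: enn2real_mult)

text \<open>Tonelli, by induction on the number of blocks. The factors take
  \<open>restrict \<tau> C\<close> because points of \<open>Pi\<^sub>M C M\<close> are extensional
  functions on \<open>C\<close>.\<close>

lemma (in product_sigma_finite) nn_integral_PiM_Union_disjoint:
  fixes f :: "'i set \<Rightarrow> ('i \<Rightarrow> 'a) \<Rightarrow> ennreal"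
  assumes "finite P" "disjoint P" "\<And>C. C \<in> P \<Longrightarrow> finite C"
    and "\<And>C. C \<in> P \<Longrightarrow> f C \<in> borel_measurable (Pi\<^sub>M C M)"
  shows "(\<integral>\<^sup>+\<tau>. (\<Prod>C\<in>P. f C (restrict \<tau> C)) \<partial>Pi\<^sub>M (\<Union>P) M)
           = (\<Prod>C\<in>P. \<integral>\<^sup>+\<tau>. f C \<tau> \<partial>Pi\<^sub>M C M)"
  using assms
proof (induction P rule: finite_induct)
  case empty
  show ?case by (simp add: PiM_empty)
next
  case (insert A P)
  let ?g = "\<lambda>\<tau>. \<Prod>C\<in>P. f C (restrict \<tau> C)"
  have disj: "A \<inter> \<Union>P = {}"
    using insert.hyps insert.prems(1) by (force simp: disjoint_def)
  have "finite A" "finite (\<Union>P)"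
    using insert.hyps insert.prems(2) by auto
  have restr: "(\<lambda>\<tau>. f C (restrict \<tau> C)) \<in> borel_measurable (Pi\<^sub>M D M)"
    if "C \<in> insert A P" "C \<subseteq> D" for C D
    using insert.prems(3)[OF that(1)] measurable_restrict_subset[OF that(2)]
    by (rule measurable_compose[rotated])
  have g: "?g \<in> borel_measurable (Pi\<^sub>M (\<Union>P) M)"
    by (intro borel_measurable_prod_ennreal restr) auto
  have "(\<integral>\<^sup>+\<tau>. (\<Prod>C\<in>insert A P. f C (restrict \<tau> C)) \<partial>Pi\<^sub>M (\<Union>(insert A P)) M)
      = (\<integral>\<^sup>+\<tau>. f A (restrict \<tau> A) * ?g \<tau> \<partial>Pi\<^sub>M (A \<union> \<Union>P) M)"
    using insert.hyps by simp
  \<comment> \<open>Tonelli: a point over \<open>A \<union> \<Union>P\<close> is merged from a point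
    \<open>\<sigma>\<close> over \<open>A\<close> and a point \<open>\<rho>\<close> over
    \<open>\<Union>P\<close>.\<close>
  also have "\<dots> = (\<integral>\<^sup>+\<sigma>. \<integral>\<^sup>+\<rho>. f A (restrict (merge A (\<Union>P) (\<sigma>, \<rho>)) A)
      * ?g (merge A (\<Union>P) (\<sigma>, \<rho>)) \<partial>Pi\<^sub>M (\<Union>P) M \<partial>Pi\<^sub>M A M)"
    using disj \<open>finite A\<close> \<open>finite (\<Union>P)\<close>
    by (intro product_nn_integral_fold borel_measurable_times_ennreal
        borel_measurable_prod_ennreal restr) auto
  also have "\<dots> = (\<integral>\<^sup>+\<sigma>. \<integral>\<^sup>+\<rho>. f A \<sigma> * ?g \<rho> \<partial>Pi\<^sub>M (\<Union>P) M \<partial>Pi\<^sub>M A M)"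
  proof (intro nn_integral_cong arg_cong2[where f = "(*)"] prod.cong refl)
    \<comment> \<open>Membership in the space makes \<open>\<sigma>\<close> extensional on
      \<open>A\<close>, so restricting the merged point to \<open>A\<close> returns exactly
      \<open>\<sigma>\<close>.\<close>
    fix \<sigma> \<rho> :: "'i \<Rightarrow> 'a" assume "\<sigma> \<in> space (Pi\<^sub>M A M)"
    then show "f A (restrict (merge A (\<Union>P) (\<sigma>, \<rho>)) A) = f A \<sigma>"
      using disj by (auto simp: space_PiM)
  next
    fix \<sigma> \<rho> :: "'i \<Rightarrow> 'a" and C assume "C \<in> P"
    then have "restrict (merge A (\<Union>P) (\<sigma>, \<rho>)) C = restrict \<rho> C"
      using disj by (auto simp: merge_def restrict_def fun_eq_iff)
    then show "f C (restrict (merge A (\<Union>P) (\<sigma>, \<rho>)) C) = f C (restrict \<rho> C)"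
      by simp
  qed
  also have "\<dots> = (\<integral>\<^sup>+\<sigma>. f A \<sigma> \<partial>Pi\<^sub>M A M) * (\<integral>\<^sup>+\<rho>. ?g \<rho> \<partial>Pi\<^sub>M (\<Union>P) M)"
    using g insert.prems(3) by (simp add: nn_integral_cmult nn_integral_multc)
  also have "(\<integral>\<^sup>+\<rho>. ?g \<rho> \<partial>Pi\<^sub>M (\<Union>P) M) = (\<Prod>C\<in>P. \<integral>\<^sup>+\<tau>. f C \<tau> \<partial>Pi\<^sub>M C M)"
    using insert.prems by (intro insert.IH) (auto simp: disjoint_def)
  finally show ?case using insert.hyps by simp
qed

text \<open>If some factor has infinite integral, both sides have the junk value 0.\<close>

lemma (in product_sigma_finite) integral_PiM_Union_disjoint_nonneg:
  fixes f :: "'i set \<Rightarrow> ('i \<Rightarrow> 'a) \<Rightarrow> real"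
  assumes "finite P" "disjoint P" "\<And>C. C \<in> P \<Longrightarrow> finite C"
    and meas: "\<And>C. C \<in> P \<Longrightarrow> f C \<in> borel_measurable (Pi\<^sub>M C M)"
    and nonneg: "\<And>C \<tau>. C \<in> P \<Longrightarrow> 0 \<le> f C \<tau>"
  shows "(LINT \<tau>|Pi\<^sub>M (\<Union>P) M. (\<Prod>C\<in>P. f C (restrict \<tau> C))) = (\<Prod>C\<in>P. LINT \<tau>|Pi\<^sub>M C M. f C \<tau>)"
proof -
  have "(\<lambda>\<tau>. f C (restrict \<tau> C)) \<in> borel_measurable (Pi\<^sub>M (\<Union>P) M)" if "C \<in> P" for C
    using meas[OF that] measurable_restrict_subset[OF Union_upper[OF that]]
    by (rule measurable_compose[rotated])
  then have "(LINT \<tau>|Pi\<^sub>M (\<Union>P) M. (\<Prod>C\<in>P. f C (restrict \<tau> C)))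
      = enn2real (\<integral>\<^sup>+\<tau>. ennreal (\<Prod>C\<in>P. f C (restrict \<tau> C)) \<partial>Pi\<^sub>M (\<Union>P) M)"
    using nonneg by (intro integral_eq_nn_integral borel_measurable_prod AE_I2 prod_nonneg) auto
  also have "\<dots> = enn2real (\<integral>\<^sup>+\<tau>. (\<Prod>C\<in>P. ennreal (f C (restrict \<tau> C))) \<partial>Pi\<^sub>M (\<Union>P) M)"
    using nonneg by (simp add: prod_ennreal)
  also have "\<dots> = (\<Prod>C\<in>P. enn2real (\<integral>\<^sup>+\<tau>. ennreal (f C \<tau>) \<partial>Pi\<^sub>M C M))"
    using assms by (subst nn_integral_PiM_Union_disjoint) (auto simp: enn2real_prod)
  also have "\<dots> = (\<Prod>C\<in>P. LINT \<tau>|Pi\<^sub>M C M. f C \<tau>)"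
    using meas nonneg by (intro prod.cong refl integral_eq_nn_integral[symmetric]) auto
  finally show ?thesis .
qed

lemma edge_cosh_pos: "0 < edge_cosh \<tau> p"
  by (cases p) (simp add: cosh_real_pos)

lemma edge_cosh_restrict:
  "set_uprod p \<subseteq> C \<Longrightarrow> edge_cosh (restrict \<tau> C) p = edge_cosh \<tau> p"
  by (cases p) simp

lemma borel_measurable_cosh_real [measurable]: "(cosh :: real \<Rightarrow> real) \<in> borel_measurable borel"
  by (intro borel_measurable_continuous_onI continuous_intros)

lemma borel_measurable_edge_cosh:
  assumes "set_uprod p \<subseteq> C"
  shows "(\<lambda>\<tau>. edge_cosh \<tau> p) \<in> borel_measurable (\<Pi>\<^sub>M v\<in>C. lborel)"
proof (cases p)
  case (Upair u v)
  with assms have [simp]: "u \<in> C" "v \<in> C" by auto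
  show ?thesis unfolding Upair edge_cosh_Upair by measurable
qed

text \<open>Unordered ends make adjacency symmetric, and its reflexive transitive closure inherits
  this. The quotient is therefore the partition of the vertices into components.\<close>

lemma equiv_reachable: "equiv (verts H) (reachable H)"
proof (rule equivI)
  have "sym (adjacency H)"
    by (fastforce simp: sym_def adjacency_def intro: rev_bexI)
  then have "sym ((adjacency H)\<^sup>*)"
    by (rule sym_rtrancl)
  then show "sym (reachable H)"
    by (auto simp: sym_def reachable_def)
qed (auto simp: reachable_def refl_on_def trans_def)

text \<open>Naming the integrand lets it be factored pointwise, before any integration.\<close>

definition zono_integrand ::
  "('v, 'e) multigraph \<Rightarrow> ('v \<Rightarrow> real) \<Rightarrow> ('e \<Rightarrow> real) \<Rightarrow> real \<Rightarrow> ('v \<Rightarrow> real) \<Rightarrow> real" where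
  "zono_integrand H x y a \<tau> =
     (\<Prod>v\<in>verts H. (2 * cosh (\<tau> v)) powr (- a * x v)) *
     (\<Prod>e\<in>edges H. edge_cosh \<tau> (ends H e) powr (- a * y e))"

lemma zono_integral_eq:
  "zono_integral H x y a =
     a ^ card (verts H) * (LINT \<tau>|(\<Pi>\<^sub>M v\<in>verts H. lborel). zono_integrand H x y a \<tau>)"
  by (simp add: zono_integral_def zono_integrand_def)

lemma zono_integrand_nonneg: "0 \<le> zono_integrand H x y a \<tau>"
  by (simp add: zono_integrand_def prod_nonneg)

text \<open>An edge factor is measurable once both its coordinates belong to the index set. Induced
  multigraphs satisfy this condition by construction.\<close>

lemma borel_measurable_zono_integrand:
  assumes "\<And>e. e \<in> edges H \<Longrightarrow> set_uprod (ends H e) \<subseteq> verts H"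
  shows "zono_integrand H x y a \<in> borel_measurable (\<Pi>\<^sub>M v\<in>verts H. lborel)"
proof -
  note [measurable] = borel_measurable_edge_cosh[OF assms]
  show ?thesis unfolding zono_integrand_def by measurable
qed

lemma verts_induced_multigraph [simp]: "verts (induced_multigraph H C) = C"
  and edges_induced_multigraph [simp]:
    "edges (induced_multigraph H C) = {e \<in> edges H. set_uprod (ends H e) \<subseteq> C}"
  and ends_induced_multigraph [simp]: "ends (induced_multigraph H C) = ends H"
  by (simp_all add: induced_multigraph_def)

text \<open>The ends of an edge are adjacent, so the class of one end contains both and the edge
  survives in the multigraph induced there.\<close>

lemma edges_eq_UN_components:
  assumes "finite_loopless_multigraph H"
  shows "edges H = (\<Union>C\<in>verts H // reachable H. edges (induced_multigraph H C))"
proof (intro equalityI subsetI)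
  fix e assume e: "e \<in> edges H"
  obtain u v where uv: "ends H e = Upair u v" by (cases "ends H e")
  with assms e have "u \<in> verts H" "v \<in> verts H"
    by (force simp: finite_loopless_multigraph_def)+
  moreover from e uv have "(u, v) \<in> adjacency H"
    by (auto simp: adjacency_def)
  ultimately have "{u, v} \<subseteq> reachable H `` {u}"
    by (auto simp: reachable_def)
  with e uv \<open>u \<in> verts H\<close>
  show "e \<in> (\<Union>C\<in>verts H // reachable H. edges (induced_multigraph H C))"
    by (auto intro!: bexI[of _ "reachable H `` {u}"] quotientI)
qed auto

text \<open>Vertex and edge products are both regrouped by component. Each resulting factor sees
  only the coordinates in its own \<open>C\<close>, which justifies the \<open>restrict\<close> that
  the Tonelli lemma expects.\<close>

lemma zono_integrand_eq_prod_components: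
  assumes "finite_loopless_multigraph H"
  shows "zono_integrand H x y a \<tau> =
    (\<Prod>C\<in>verts H // reachable H. zono_integrand (induced_multigraph H C) x y a (restrict \<tau> C))"
proof -
  let ?P = "verts H // reachable H"
  have fin: "finite (verts H)" "finite (edges H)"
    using assms by (auto simp: finite_loopless_multigraph_def)
  have "reachable H \<subseteq> verts H \<times> verts H"
    by (auto simp: reachable_def)
  with fin have finP: "finite ?P" "\<And>C. C \<in> ?P \<Longrightarrow> finite C"
    by (auto intro: finite_quotient finite_equiv_class)
  have disj: "C \<inter> D = {}" if "C \<in> ?P" "D \<in> ?P" "C \<noteq> D" for C D
    using quotient_disj[OF equiv_reachable that(1,2)] that(3) by blast
  have edisj: "edges (induced_multigraph H C) \<inter> edges (induced_multigraph H D) = {}"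
    if "C \<in> ?P" "D \<in> ?P" "C \<noteq> D" for C D
  proof -
    \<comment> \<open>A common edge would have its nonempty set of ends inside the empty set
      \<open>C \<inter> D\<close>.\<close>
    have "set_uprod (ends H e) \<noteq> {}" for e
      by (cases "ends H e") auto
    with disj[OF that] show ?thesis by fastforce
  qed
  have "(\<Prod>v\<in>verts H. (2 * cosh (\<tau> v)) powr (- a * x v))
      = (\<Prod>C\<in>?P. \<Prod>v\<in>C. (2 * cosh (\<tau> v)) powr (- a * x v))"
    using finP disj prod.Union_disjoint[of ?P "\<lambda>v. (2 * cosh (\<tau> v)) powr (- a * x v)"]
    by (auto simp: Union_quotient[OF equiv_reachable])
  moreover have "(\<Prod>e\<in>edges H. edge_cosh \<tau> (ends H e) powr (- a * y e))
      = (\<Prod>C\<in>?P. \<Prod>e\<in>edges (induced_multigraph H C). edge_cosh \<tau> (ends H e) powr (- a * y e))"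
    using finP(1) fin(2) edisj
    by (subst edges_eq_UN_components[OF assms], intro prod.UNION_disjoint) auto
  ultimately show ?thesis
    by (auto simp: zono_integrand_def edge_cosh_restrict simp flip: prod.distrib
        intro!: prod.cong arg_cong2[where f = "(*)"])
qed

theorem zono_integral_eq_prod_components:
  assumes H: "finite_loopless_multigraph H"
  shows "zono_integral H x y a = (\<Prod>K\<in>components_multigraph H. zono_integral K x y a)"
proof -
  interpret product_sigma_finite "\<lambda>_ :: 'a. lborel :: real measure" ..
  let ?P = "verts H // reachable H"
  have fin: "finite (verts H)"
    using H by (auto simp: finite_loopless_multigraph_def)
  have sub: "reachable H \<subseteq> verts H \<times> verts H"
    by (auto simp: reachable_def)
  have finP: "finite ?P" and finC: "\<And>C. C \<in> ?P \<Longrightarrow> finite C"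
    using finite_quotient[OF fin sub] finite_equiv_class[OF fin sub] by auto
  have disj: "disjoint ?P"
    using quotient_disj[OF equiv_reachable] by (fastforce simp: disjoint_def)
  have U: "\<Union>?P = verts H"
    by (rule Union_quotient[OF equiv_reachable])
  \<comment> \<open>The product in the goal runs over a set of multigraphs, so distinct classes must
    give distinct ones, or factors would be lost; the class is recovered as the vertex set.\<close>
  have inj: "inj_on (induced_multigraph H) ?P"
    by (metis inj_onI verts_induced_multigraph)
  have "card (verts H) = (\<Sum>C\<in>?P. card C)"
    using card_Union_disjoint[of ?P] disj finC
    by (simp add: U pairwise_def disjoint_def disjnt_def)
  moreover have "(LINT \<tau>|(\<Pi>\<^sub>M v\<in>verts H. lborel). zono_integrand H x y a \<tau>)
      = (\<Prod>C\<in>?P. LINT \<tau>|(\<Pi>\<^sub>M v\<in>C. lborel). zono_integrand (induced_multigraph H C) x y a \<tau>)"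
    \<comment> \<open>The integrand now has the blockwise form of the Tonelli lemma, whose domain
      \<open>\<Union>?P\<close> is rewritten to \<open>verts H\<close> by \<open>U\<close>.\<close>
    unfolding zono_integrand_eq_prod_components[OF H]
    using borel_measurable_zono_integrand[of "induced_multigraph H _"]
    by (intro integral_PiM_Union_disjoint_nonneg[OF finP disj, unfolded U])
       (auto simp: finC zono_integrand_nonneg)
  ultimately show ?thesis
    by (simp add: zono_integral_eq components_multigraph_def prod.reindex[OF inj] prod.distrib power_sum)
qed

lemma zono_integral_delete_edges:
  assumes "finite (edges G)"
  shows "zono_integral G x (\<lambda>e. if e \<in> I then 0 else y e) a = zono_integral (delete_edges G I) x y a"
proof -
  have "(\<Prod>e\<in>edges G. edge_cosh \<tau> (ends G e) powr (- a * (if e \<in> I then 0 else y e)))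
      = (\<Prod>e\<in>edges G - I. edge_cosh \<tau> (ends G e) powr (- a * y e))" for \<tau>
    \<comment> \<open>The base must be known to be nonzero, since \<open>0 powr 0 = 0\<close>; only
      then are the factors from \<open>I\<close> equal to 1.\<close>
    using edge_cosh_pos[THEN less_imp_neq, symmetric] assms
    by (intro prod.mono_neutral_cong_right) auto
  then show ?thesis
    by (simp add: zono_integral_def delete_edges_def)
qed

theorem mainTheorem7:
  fixes G :: "('v, 'e) multigraph"
    and I :: "'e set"
    and x :: "'v \<Rightarrow> real"
    and y :: "'e \<Rightarrow> real"
    and a :: real
  assumes "finite_loopless_multigraph G"
    and "connected_multigraph G"
    and "I \<subseteq> edges G"
    and "\<And>v. v \<in> verts G \<Longrightarrow> x v > 0"
    and "\<And>e. e \<in> edges G - I \<Longrightarrow> y e > 0"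
    and "a > 0"
  shows "zono_integral G x (\<lambda>e. if e \<in> I then 0 else y e) a
           = zono_integral (delete_edges G I) x y a
       \<and> zono_integral (delete_edges G I) x y a
           = (\<Prod>K\<in>components_multigraph (delete_edges G I). zono_integral K x y a)"
proof
  show "zono_integral G x (\<lambda>e. if e \<in> I then 0 else y e) a = zono_integral (delete_edges G I) x y a"
    using assms(1) by (simp add: finite_loopless_multigraph_def zono_integral_delete_edges)
  have "finite_loopless_multigraph (delete_edges G I)"
    using assms(1) by (auto simp: finite_loopless_multigraph_def delete_edges_def)
  then show "zono_integral (delete_edges G I) x y a
      = (\<Prod>K\<in>components_multigraph (delete_edges G I). zono_integral K x y a)"
    by (rule zono_integral_eq_prod_components)
qed

end
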